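(* Let $a>0$ and $b>0$, and put $E(x)=e^{-ax^{2}-bx}$, $W(x)=\sqrt\pi\,e^{\frac{b^{2}}{4a}}\operatorname{erf}\left(\frac{2ax+b}{2\sqrt a}\right)$ and $P(x)=\frac{15}{b^{3}x^{3}}+\frac{15}{b^{2}x^{2}}+\frac{6}{bx}+1$. On $(0,\infty)$: (i) $$\sqrt{\tfrac{2}{\pi}}\int e^{-ax^{2}}b^{\frac72}x^{1+\frac12}K_{\frac72}(bx)\,dx=b^{3}\int xP(x)E(x)\,dx=-\frac{(60a^{2}-12ab^{2}+b^{4})W(x)}{4a^{3/2}}-\frac{(30a+b^{3}x)E(x)}{2ax};$$ (ii) $$\sqrt{\tfrac{2}{\pi}}\int e^{-ax^{2}}b^{\frac72}x^{-1+\frac12}K_{\frac72}(bx)\,dx=b^{3}\int \frac1xP(x)E(x)\,dx=\sqrt a\,(10a-b^{2})W(x)+\frac{E(x)}{x^{3}}\left(10ax^{2}-b^{2}x^{2}-5bx-5\right);$$ (iii) $$\sqrt{\tfrac{2}{\pi}}\int e^{-ax^{2}}b^{\frac72}x^{-3+\frac12}K_{\frac72}(bx)\,dx=b^{3}\int \frac1{x^{3}}P(x)E(x)\,dx$$ $$=E(x)\left(-\frac{4a^{2}}{x}+\frac{2a-b^{2}}{x^{3}}+\frac{2ab}{x^{2}}-\frac{3b}{x^{4}}-\frac{3}{x^{5}}\right)-4a^{5/2}W(x).$$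
   Context: $K_\mu$ is the Macdonald function (modified Bessel function of the second kind); $\operatorname{erf}(z)=\frac{2}{\sqrt\pi}\int_0^z e^{-t^2}dt$. An identity $\int f\,dx=\int g\,dx=F$ means that $f=g$ on $(0,\infty)$ and that $F$ is an antiderivative of this function on $(0,\infty)$. *)

theory Defs
  imports "HOL-Analysis.Analysis"
begin

text \<open>
  Modified Bessel functions of real order \<open>\<nu>\<close> at a real argument \<open>x > 0\<close>; the values at
  \<open>x \<le> 0\<close> carry no meaning. The reciprocal Gamma function vanishes at the nonpositive integers,
  so the series for the first kind is correct for negative integer orders as well.
\<close>

definition bessel_I :: "real \<Rightarrow> real \<Rightarrow> real" where
  "bessel_I \<nu> x = (\<Sum>k. rGamma (\<nu> + real k + 1) / fact k * (x / 2) powr (2 * real k + \<nu>))"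

text \<open>
  The Macdonald function \<open>K\<^sub>\<mu>\<close>, defined by the usual quotient for non-integer order and by
  continuity in the order when the order is an integer.
\<close>

definition bessel_K_nonint :: "real \<Rightarrow> real \<Rightarrow> real" where
  "bessel_K_nonint \<nu> x = pi / 2 * (bessel_I (- \<nu>) x - bessel_I \<nu> x) / sin (\<nu> * pi)"

definition macdonald_K :: "real \<Rightarrow> real \<Rightarrow> real" where
  "macdonald_K \<mu> x =
     (if \<mu> \<in> \<int> then Lim (at \<mu>) (\<lambda>\<nu>. bessel_K_nonint \<nu> x) else bessel_K_nonint \<mu> x)"

text \<open>The interval integral is oriented, so this is also correct for negative arguments.\<close>

definition erf :: "real \<Rightarrow> real" where
  "erf z = 2 / sqrt pi * (LBINT t=ereal 0..ereal z. exp (- t\<^sup>2))"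

text \<open>The meaning of \<open>\<integral> f dx = \<integral> g dx = F\<close> on \<open>(0, \<infinity>)\<close>, as an identity of indefinite integrals.\<close>

definition indef_integrals_eq ::
    "(real \<Rightarrow> real) \<Rightarrow> (real \<Rightarrow> real) \<Rightarrow> (real \<Rightarrow> real) \<Rightarrow> bool" where
  "indef_integrals_eq f g F \<longleftrightarrow>
     (\<forall>x>0. f x = g x) \<and> (\<forall>x>0. (F has_real_derivative f x) (at x))"

end

theory Submission
  imports Defs
begin

text \<open>
  The three-term recurrence \<open>K\<^bsub>\<nu>+1\<^esub>(x) = K\<^bsub>\<nu>-1\<^esub>(x) + (2\<nu>/x) K\<^bsub>\<nu>\<^esub>(x)\<close> follows from the power series, and
  the orders \<open>\<plusminus>1/2\<close> are elementary because their series are those of \<open>cosh\<close> and \<open>sinh\<close>. Three steps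
  of the recurrence give \<open>K\<^bsub>7/2\<^esub>\<close> in closed form, so the Bessel integrands become rational
  functions times \<open>E\<close>. Since \<open>W' = 2 \<surd>a E\<close> and \<open>E' = -(2ax + b) E\<close>, each antiderivative is then
  checked by comparing rational functions.
\<close>

section \<open>Power series of the Bessel functions and the three-term recurrence\<close>

lemma summable_bessel_I:
  assumes x: "x > 0"
  shows "summable (\<lambda>k. rGamma (\<nu> + real k + 1) / fact k * (x / 2) powr (2 * real k + \<nu>))"
proof (rule summable_ratio_test)
  let ?f = "\<lambda>k. rGamma (\<nu> + real k + 1) / fact k * (x / 2) powr (2 * real k + \<nu>)"
  \<comment> \<open>From \<open>N\<close> on, \<nu> + k + 1 is positive and at least
    \<open>x^2\<close>. The ratio of consecutive terms has absolute value \<open>(x/2)^2\<close>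
    over (\<nu> + k + 1)(k + 1), so it is then at most 1/2.\<close>
  define N where "N = nat \<lceil>\<bar>\<nu>\<bar> + x\<^sup>2\<rceil>"
  fix k assume "k \<ge> N"
  then have k: "\<bar>\<nu>\<bar> + x\<^sup>2 \<le> real k" unfolding N_def by linarith
  let ?d = "\<nu> + real k + 1"
  have d: "?d > 0" and dx: "x\<^sup>2 \<le> ?d" using k zero_le_power2[of x] by linarith+
  have "rGamma ?d = ?d * rGamma (\<nu> + real (Suc k) + 1)"
    using rGamma_plus1[of ?d] by (simp add: algebra_simps)
  moreover have "(x / 2) powr (2 * real (Suc k) + \<nu>) = (x / 2) powr (2 * real k + \<nu>) * (x / 2)\<^sup>2"
    using x by (simp add: powr_add[symmetric] powr_numeral[symmetric] del: powr_numeral) (simp add: algebra_simps)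
  \<comment> \<open>The ratio is kept in multiplied-out form because terms of the series may vanish,
    namely at the poles of Gamma.\<close>
  ultimately have eq: "?f (Suc k) * (?d * (1 + real k)) = ?f k * (x / 2)\<^sup>2"
    by (simp only: fact_Suc of_nat_Suc) (simp add: divide_simps)
  have dk: "?d * 1 \<le> ?d * (1 + real k)" using d by (intro mult_left_mono) auto
  have "(x / 2)\<^sup>2 \<le> 1 / 2 * ?d" using dx d by (simp add: power_divide)
  also have "\<dots> \<le> 1 / 2 * (?d * (1 + real k))" using dk by linarith
  finally have "\<bar>?f k\<bar> * (x / 2)\<^sup>2 \<le> \<bar>?f k\<bar> * (1 / 2 * (?d * (1 + real k)))"
    by (intro mult_left_mono) auto
  moreover have "\<bar>?f (Suc k)\<bar> * (?d * (1 + real k)) = \<bar>?f k\<bar> * (x / 2)\<^sup>2"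
    using arg_cong[OF eq, of abs] d by (simp only: abs_mult) simp
  ultimately have "\<bar>?f (Suc k)\<bar> * (?d * (1 + real k)) \<le> (1 / 2 * \<bar>?f k\<bar>) * (?d * (1 + real k))"
    by (simp only: ac_simps)
  then show "norm (?f (Suc k)) \<le> 1 / 2 * norm (?f k)"
    unfolding real_norm_def by (rule mult_right_le_imp_le) (use d in simp)
qed simp

lemma bessel_I_sums:
  assumes "x > 0"
  shows "(\<lambda>k. rGamma (\<nu> + real k + 1) / fact k * (x / 2) powr (2 * real k + \<nu>)) sums bessel_I \<nu> x"
  unfolding bessel_I_def using summable_bessel_I[OF assms] by (rule summable_sums)

text \<open>Termwise, the functional equation of \<open>rGamma\<close> gives the order \<nu> - 1
  series the factor \<nu> + k, and the multiple of the order \<nu> series removes \<nu>. The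
  remaining factor k kills the term at 0 and cancels against the factorial, so shifting the index by
  one yields the order \<nu> + 1 series. As \<open>rGamma\<close> is entire, no order is
  exceptional.\<close>

lemma bessel_I_recurrence:
  assumes x: "x > 0"
  shows "bessel_I (\<nu> - 1) x - bessel_I (\<nu> + 1) x = 2 * \<nu> / x * bessel_I \<nu> x"
proof -
  let ?f = "\<lambda>\<nu> k. rGamma (\<nu> + real k + 1) / fact k * (x / 2) powr (2 * real k + \<nu>)"
  define g where "g = (\<lambda>k. ?f (\<nu> - 1) k - 2 * \<nu> / x * ?f \<nu> k)"
  have half: "(x / 2) powr (r + 1) = (x / 2) powr r * (x / 2)" for r
    using x by (simp add: powr_add)
  have g: "g k = real k * rGamma (\<nu> + real k + 1) / fact k * (x / 2) powr (2 * real k + \<nu> - 1)" for k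
  proof -
    have "rGamma (\<nu> - 1 + real k + 1) = (\<nu> + real k) * rGamma (\<nu> + real k + 1)"
      using rGamma_plus1[of "\<nu> + real k"] by simp
    then show ?thesis
      using half[of "2 * real k + \<nu> - 1"] x by (simp add: g_def field_simps)
  qed
  have "g sums (bessel_I (\<nu> - 1) x - 2 * \<nu> / x * bessel_I \<nu> x)"
    unfolding g_def by (intro sums_diff sums_mult bessel_I_sums x)
  moreover have "g 0 = 0" by (simp add: g)
  ultimately have "(\<lambda>k. g (Suc k)) sums (bessel_I (\<nu> - 1) x - 2 * \<nu> / x * bessel_I \<nu> x)"
    by (simp add: sums_Suc_iff)
  moreover have "g (Suc k) = ?f (\<nu> + 1) k" for k
  proof -
    have "\<nu> + real (Suc k) + 1 = \<nu> + 1 + real k + 1"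
      "2 * real (Suc k) + \<nu> - 1 = 2 * real k + (\<nu> + 1)" by simp_all
    moreover have "real (Suc k) / fact (Suc k) = 1 / fact k" by (simp add: divide_simps)
    ultimately show ?thesis
      unfolding g by (metis (no_types) times_divide_eq_left mult.commute mult_1)
  qed
  ultimately have "?f (\<nu> + 1) sums (bessel_I (\<nu> - 1) x - 2 * \<nu> / x * bessel_I \<nu> x)"
    by (simp only:)
  then have "bessel_I (\<nu> - 1) x - 2 * \<nu> / x * bessel_I \<nu> x = bessel_I (\<nu> + 1) x"
    using bessel_I_sums[OF x, of "\<nu> + 1"] by (rule sums_unique2)
  then show ?thesis by simp
qed

text \<open>Combine the recurrences for I at \<nu> and at -\<nu>. Shifting the order by one flips
  the sign of the sine in the denominator, which produces the plus sign in the recurrence for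
  K.\<close>

lemma bessel_K_nonint_recurrence:
  assumes "x > 0"
  shows "bessel_K_nonint (\<nu> + 1) x = bessel_K_nonint (\<nu> - 1) x + 2 * \<nu> / x * bessel_K_nonint \<nu> x"
proof -
  have s: "sin ((\<nu> + 1) * pi) = - sin (\<nu> * pi)" "sin ((\<nu> - 1) * pi) = - sin (\<nu> * pi)"
    by (simp_all add: distrib_right left_diff_distrib sin_add sin_diff)
  have n: "- (\<nu> + 1) = - \<nu> - 1" "- (\<nu> - 1) = - \<nu> + 1"
    by simp_all
  have "bessel_I (- (\<nu> + 1)) x - bessel_I (\<nu> + 1) x
      = bessel_I (- (\<nu> - 1)) x - bessel_I (\<nu> - 1) x
        - 2 * \<nu> / x * (bessel_I (- \<nu>) x - bessel_I \<nu> x)"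
    using bessel_I_recurrence[OF assms, of \<nu>] bessel_I_recurrence[OF assms, of "- \<nu>"]
    unfolding n by (simp add: algebra_simps)
  then show ?thesis
    unfolding bessel_K_nonint_def s
    \<comment> \<open>If the sine vanishes, all three quotients are 0 by the convention for division
      by zero.\<close>
    by (cases "sin (\<nu> * pi) = 0") (simp_all add: divide_simps, simp_all add: algebra_simps)
qed

section \<open>Closed forms at half-integer orders\<close>

lemma rGamma_half_plus_nat:
  "rGamma (real k + 1 / 2) = 4 ^ k * fact k / (sqrt pi * fact (2 * k))"
proof (induction k)
  case 0
  show ?case by (simp add: rGamma_inverse_Gamma Gamma_one_half_real field_simps)
next
  case (Suc k)
  \<comment> \<open>The functional equation steps up from Gamma(1/2) = \<open>sqrt pi\<close>; the
    factor k + 1/2 is nonzero and may be divided out.\<close>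
  have "rGamma (real k + 1 / 2) = (real k + 1 / 2) * rGamma (real (Suc k) + 1 / 2)"
    using rGamma_plus1[of "real k + 1 / 2"] by (simp add: algebra_simps)
  moreover have "(real k + 1 / 2) \<noteq> 0" by linarith
  ultimately have "rGamma (real (Suc k) + 1 / 2) = rGamma (real k + 1 / 2) / (real k + 1 / 2)"
    by simp
  moreover have "fact (2 * Suc k) = 4 * (real k + 1) * (real k + 1 / 2) * fact (2 * k)"
    by (simp add: algebra_simps)
  moreover have "fact (Suc k) = (real k + 1) * fact k" by simp
  moreover have "(real k + 1) \<noteq> 0" by linarith
  ultimately show ?case
    using \<open>(real k + 1 / 2) \<noteq> 0\<close> unfolding Suc by (simp only: power_Suc) (simp add: divide_simps)
qed

text \<open>The half-integer value of \<open>rGamma\<close> supplies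
  \<open>4^k * fact k / fact (2 * k)\<close>: the power of 4 and \<open>fact k\<close> cancel,
  leaving the even exponential terms.\<close>

lemma bessel_I_minus_half:
  assumes x: "x > 0"
  shows "bessel_I (- 1 / 2) x = sqrt (2 / (pi * x)) * cosh x"
proof -
  have "(\<lambda>n. if even n then x ^ n / fact n else 0) sums cosh x"
    using cosh_converges[of x] by (simp add: divide_inverse mult.commute cong: if_cong)
  then have "(\<lambda>k. x ^ (2 * k) / fact (2 * k)) sums cosh x"
    \<comment> \<open>The odd terms are zero, so the series may be reindexed along the even
      numbers.\<close>
    by (subst (asm) sums_mono_reindex[of "\<lambda>k. 2 * k", symmetric]) (auto simp: strict_mono_def)
  then have "(\<lambda>k. sqrt (2 / (pi * x)) * (x ^ (2 * k) / fact (2 * k))) sums (sqrt (2 / (pi * x)) * cosh x)"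
    by (rule sums_mult)
  moreover have "rGamma (- 1 / 2 + real k + 1) / fact k * (x / 2) powr (2 * real k + - 1 / 2)
      = sqrt (2 / (pi * x)) * (x ^ (2 * k) / fact (2 * k))" for k
  proof -
    have p: "(x / 2) powr (2 * real k + - 1 / 2) = x ^ (2 * k) / 4 ^ k * sqrt (2 / x)"
      using x powr_realpow[of "x / 2" "2 * k"]
      by (simp add: powr_diff powr_half_sqrt power_divide power_mult real_sqrt_divide)
    have q: "rGamma (- 1 / 2 + real k + 1) = 4 ^ k * fact k / (sqrt pi * fact (2 * k))"
      using rGamma_half_plus_nat[of k] by (simp add: algebra_simps)
    show ?thesis unfolding p q by (simp add: real_sqrt_divide real_sqrt_mult field_simps)
  qed
  ultimately show ?thesis
    using bessel_I_sums[OF x, of "- 1 / 2"] sums_unique2 by (metis (no_types, lifting) sums_cong)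
qed

lemma bessel_I_half:
  assumes x: "x > 0"
  shows "bessel_I (1 / 2) x = sqrt (2 / (pi * x)) * sinh x"
proof -
  have "(\<lambda>n. if even n then 0 else x ^ n / fact n) sums sinh x"
    using sinh_converges[of x] by (simp add: divide_inverse mult.commute cong: if_cong)
  then have "(\<lambda>k. x ^ (2 * k + 1) / fact (2 * k + 1)) sums sinh x"
    by (subst (asm) sums_mono_reindex[of "\<lambda>k. 2 * k + 1", symmetric])
       (auto simp: strict_mono_def elim!: oddE)
  then have "(\<lambda>k. sqrt (2 / (pi * x)) * (x ^ (2 * k + 1) / fact (2 * k + 1))) sums (sqrt (2 / (pi * x)) * sinh x)"
    by (rule sums_mult)
  moreover have "rGamma (1 / 2 + real k + 1) / fact k * (x / 2) powr (2 * real k + 1 / 2)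
      = sqrt (2 / (pi * x)) * (x ^ (2 * k + 1) / fact (2 * k + 1))" for k
  proof -
    have p: "(x / 2) powr (2 * real k + 1 / 2) = x ^ (2 * k + 1) / (2 * 4 ^ k) * sqrt (2 / x)"
    proof -
      have "(x / 2) powr (2 * real k + 1 / 2) = x ^ (2 * k) / 4 ^ k * sqrt (x / 2)"
        using x powr_realpow[of "x / 2" "2 * k"]
        by (simp add: powr_add powr_half_sqrt power_divide power_mult)
      \<comment> \<open>This trades the square root for the one that occurs at order -1/2, so both
        orders share the prefactor \<open>sqrt (2 / (pi * x))\<close>.\<close>
      also have "sqrt (x / 2) = x / 2 * sqrt (2 / x)"
        using x by (intro real_sqrt_unique) (simp_all add: power_mult_distrib power2_eq_square)
      finally show ?thesis by (simp add: mult_ac)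
    qed
    have q: "rGamma (1 / 2 + real k + 1) = 2 * 4 ^ k * fact k / (sqrt pi * fact (2 * k + 1))"
    proof -
      \<comment> \<open>The formula is used at k + 1, and the even factor 2(k + 1) of (2k + 2)! is
        cancelled to leave an odd factorial.\<close>
      have "rGamma (1 / 2 + real k + 1) = rGamma (real (Suc k) + 1 / 2)"
        by (simp add: algebra_simps)
      moreover have "fact (2 * Suc k) = 2 * (real k + 1) * fact (2 * k + 1)"
        by (simp add: algebra_simps)
      moreover have "fact (Suc k) = (real k + 1) * fact k" by simp
      moreover have "real k + 1 \<noteq> 0" by linarith
      ultimately show ?thesis
        by (simp only: rGamma_half_plus_nat power_Suc) (simp add: divide_simps)
    qed
    show ?thesis unfolding p q by (simp add: real_sqrt_divide real_sqrt_mult field_simps del: fact_Suc)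
  qed
  ultimately show ?thesis
    using bessel_I_sums[OF x, of "1 / 2"] sums_unique2 by (metis (no_types, lifting) sums_cong)
qed

text \<open>Here the sine is 1, and the difference of the two I functions is a multiple of cosh -
  sinh = exp(-x).\<close>

lemma bessel_K_nonint_half:
  assumes x: "x > 0"
  shows "bessel_K_nonint (1 / 2) x = sqrt (pi / (2 * x)) * exp (- x)"
proof -
  have "bessel_K_nonint (1 / 2) x = pi / 2 * sqrt (2 / (pi * x)) * exp (- x)"
    using bessel_I_half[OF x] bessel_I_minus_half[OF x]
    by (simp add: bessel_K_nonint_def right_diff_distrib[symmetric] cosh_minus_sinh)
  also have "pi / 2 * sqrt (2 / (pi * x)) = sqrt (pi / (2 * x))"
    using x by (intro real_sqrt_unique[symmetric]) (simp_all add: power_mult_distrib power_divide, simp add: power2_eq_square)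
  finally show ?thesis .
qed

lemma bessel_K_nonint_minus: "bessel_K_nonint (- \<nu>) x = bessel_K_nonint \<nu> x"
  by (simp add: bessel_K_nonint_def minus_divide_left[symmetric] algebra_simps diff_divide_distrib)

text \<open>The recurrence climbs from 1/2 through 3/2 and 5/2. Its first step involves order -1/2,
  which evenness in the order turns back into 1/2. The last factor is the Bessel polynomial of
  degree 3 in 1/x.\<close>

lemma macdonald_K_seven_halves:
  assumes x: "x > 0"
  shows "macdonald_K (7 / 2) x
    = sqrt (pi / (2 * x)) * exp (- x) * (15 / x ^ 3 + 15 / x\<^sup>2 + 6 / x + 1)"
proof -
  \<comment> \<open>This selects the quotient branch of \<open>macdonald_K\<close>, with no limit in
    the order.\<close>
  have "(7 / 2 :: real) \<notin> \<int>"
  proof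
    assume "(7 / 2 :: real) \<in> \<int>"
    then obtain n where "(7 / 2 :: real) = of_int n" by (auto elim: Ints_cases)
    then have "real_of_int (2 * n) = real_of_int 7" by simp
    then have "2 * n = 7" by (simp only: of_int_eq_iff)
    then show False by presburger
  qed
  moreover have "bessel_K_nonint (3 / 2) x = (1 + 1 / x) * bessel_K_nonint (1 / 2) x"
    using bessel_K_nonint_recurrence[OF x, of "1 / 2"] bessel_K_nonint_minus[of "1 / 2" x]
    by (simp add: algebra_simps)
  moreover have "bessel_K_nonint (5 / 2) x = bessel_K_nonint (1 / 2) x + 3 / x * bessel_K_nonint (3 / 2) x"
    using bessel_K_nonint_recurrence[OF x, of "3 / 2"] by simp
  moreover have "bessel_K_nonint (7 / 2) x = bessel_K_nonint (3 / 2) x + 5 / x * bessel_K_nonint (5 / 2) x"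
    using bessel_K_nonint_recurrence[OF x, of "5 / 2"] by simp
  ultimately show ?thesis
    using x unfolding macdonald_K_def
    by (simp add: bessel_K_nonint_half) (simp add: field_simps eval_nat_numeral)
qed

section \<open>Derivatives of erf and W, and the common Bessel integrand\<close>

lemma erf_has_real_derivative:
  "(erf has_real_derivative 2 / sqrt pi * exp (- z\<^sup>2)) (at z)"
proof -
  let ?u = "\<lambda>z. LBINT t=ereal 0..ereal z. exp (- t\<^sup>2 :: real)"
  \<comment> \<open>The interval contains 0 and has z in its interior, so either sign of z is
    covered and the derivative within the interval is a full derivative.\<close>
  define c d where "c = min 0 z - 1" and "d = max 0 z + 1"
  have "(?u has_vector_derivative exp (- z\<^sup>2)) (at z within {c..d})"
    by (rule interval_integral_FTC2) (auto simp: c_def d_def intro!: continuous_intros)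
  moreover have "z \<in> interior {c..d}" by (auto simp: c_def d_def)
  ultimately have "(?u has_real_derivative exp (- z\<^sup>2)) (at z)"
    by (simp only: at_within_interior has_real_derivative_iff_has_vector_derivative)
  then show ?thesis
    unfolding erf_def[abs_def] by (rule DERIV_cmult)
qed

text \<open>All square roots multiply to 1. The exponent \<open>s\<close> stays free so that 1, -1
  and -3 are instances.\<close>

lemma macdonald_K_seven_halves_integrand:
  assumes b: "b > 0" and x: "x > 0"
  shows "sqrt (2 / pi) *
      (exp (- a * x\<^sup>2) * b powr (7 / 2) * x powr (s + 1 / 2) * macdonald_K (7 / 2) (b * x))
    = b ^ 3 * (x powr s * (15 / (b ^ 3 * x ^ 3) + 15 / (b\<^sup>2 * x\<^sup>2) + 6 / (b * x) + 1)
        * exp (- a * x\<^sup>2 - b * x))"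
proof -
  have "b powr (7 / 2) = b powr (3 + 1 / 2)" by simp
  also have "\<dots> = b ^ 3 * sqrt b"
    unfolding powr_add using b by (simp add: powr_half_sqrt)
  finally have "b powr (7 / 2) = b ^ 3 * sqrt b" .
  moreover have "x powr (s + 1 / 2) = x powr s * sqrt x"
    using x by (simp add: powr_add powr_half_sqrt)
  moreover define q where "q = 15 / (b ^ 3 * x ^ 3) + 15 / (b\<^sup>2 * x\<^sup>2) + 6 / (b * x) + 1"
  then have "macdonald_K (7 / 2) (b * x) = sqrt (pi / (2 * (b * x))) * exp (- (b * x)) * q"
    using b x by (simp add: macdonald_K_seven_halves power_mult_distrib)
  moreover have "exp (- a * x\<^sup>2 - b * x) = exp (- a * x\<^sup>2) * exp (- (b * x))"
    by (simp add: exp_add[symmetric])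
  ultimately have "sqrt (2 / pi) *
      (exp (- a * x\<^sup>2) * b powr (7 / 2) * x powr (s + 1 / 2) * macdonald_K (7 / 2) (b * x))
    = (sqrt (2 / pi) * (sqrt b * sqrt x * sqrt (pi / (2 * (b * x)))))
        * (b ^ 3 * (x powr s * q * exp (- a * x\<^sup>2 - b * x)))"
    by (simp only: ac_simps)
  also have "sqrt (2 / pi) * (sqrt b * sqrt x * sqrt (pi / (2 * (b * x)))) = 1"
    using b x by (simp add: real_sqrt_mult[symmetric])
  finally show ?thesis by (simp only: q_def mult_1)
qed

lemma gaussian_antiderivative_erf:
  fixes a b x :: real
  assumes a: "a > 0"
  shows "((\<lambda>x. sqrt pi * exp (b\<^sup>2 / (4 * a)) * erf ((2 * a * x + b) / (2 * sqrt a)))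
    has_real_derivative 2 * sqrt a * exp (- a * x\<^sup>2 - b * x)) (at x)"
proof -
  let ?u = "\<lambda>x. (2 * a * x + b) / (2 * sqrt a)"
  have u: "(?u has_real_derivative sqrt a) (at x)"
    using a by (auto intro!: derivative_eq_intros simp: real_div_sqrt)
  have "((\<lambda>x. sqrt pi * exp (b\<^sup>2 / (4 * a)) * erf (?u x)) has_real_derivative
      sqrt pi * exp (b\<^sup>2 / (4 * a)) * (2 / sqrt pi * exp (- (?u x)\<^sup>2) * sqrt a)) (at x)"
    by (intro DERIV_cmult DERIV_chain2[OF erf_has_real_derivative u])
  \<comment> \<open>Completing the square; the constant left over is exactly what the factor
    \<open>exp (b^2 / (4 * a))\<close> in W compensates.\<close>
  moreover have "b\<^sup>2 / (4 * a) + - (?u x)\<^sup>2 = - a * x\<^sup>2 - b * x"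
    using a by (simp add: power_divide power_mult_distrib) (simp add: field_simps power2_eq_square)
  then have "exp (b\<^sup>2 / (4 * a)) * exp (- (?u x)\<^sup>2) = exp (- a * x\<^sup>2 - b * x)"
    by (simp only: exp_add[symmetric])
  then have "sqrt pi * exp (b\<^sup>2 / (4 * a)) * (2 / sqrt pi * exp (- (?u x)\<^sup>2) * sqrt a)
      = 2 * sqrt a * exp (- a * x\<^sup>2 - b * x)"
    by (simp add: mult_ac)
  ultimately show ?thesis by (simp only:)
qed

section \<open>Verification of the three antiderivatives\<close>

theorem mainTheorem4:
  fixes a b :: real and E W P :: "real \<Rightarrow> real"
  assumes a: "a > 0" and b: "b > 0"
    and E: "E = (\<lambda>x. exp (- a * x^2 - b * x))"
    and W: "W = (\<lambda>x. sqrt pi * exp (b^2 / (4 * a)) * erf ((2 * a * x + b) / (2 * sqrt a)))"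
    and P: "P = (\<lambda>x. 15 / (b^3 * x^3) + 15 / (b^2 * x^2) + 6 / (b * x) + 1)"
  shows
    "indef_integrals_eq
       (\<lambda>x. sqrt (2 / pi) *
          (exp (- a * x^2) * b powr (7/2) * x powr (1 + 1/2) * macdonald_K (7/2) (b * x)))
       (\<lambda>x. b^3 * (x * P x * E x))
       (\<lambda>x. - ((60 * a^2 - 12 * a * b^2 + b^4) * W x / (4 * a powr (3/2)))
            - (30 * a + b^3 * x) * E x / (2 * a * x))
     \<and> indef_integrals_eq
       (\<lambda>x. sqrt (2 / pi) *
          (exp (- a * x^2) * b powr (7/2) * x powr (- 1 + 1/2) * macdonald_K (7/2) (b * x)))
       (\<lambda>x. b^3 * (1 / x * P x * E x))
       (\<lambda>x. sqrt a * (10 * a - b^2) * W x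
            + E x / x^3 * (10 * a * x^2 - b^2 * x^2 - 5 * b * x - 5))
     \<and> indef_integrals_eq
       (\<lambda>x. sqrt (2 / pi) *
          (exp (- a * x^2) * b powr (7/2) * x powr (- 3 + 1/2) * macdonald_K (7/2) (b * x)))
       (\<lambda>x. b^3 * (1 / x^3 * P x * E x))
       (\<lambda>x. E x * (- (4 * a^2 / x) + (2 * a - b^2) / x^3 + 2 * a * b / x^2
                    - 3 * b / x^4 - 3 / x^5)
            - 4 * a powr (5/2) * W x)"
proof -
  \<comment> \<open>With a = \<open>s^2\<close>, the fractional powers of a become ordinary powers
    of \<open>s\<close>.\<close>
  define s where "s = sqrt a"
  have s: "s > 0" and as: "a = s\<^sup>2" using a by (simp_all add: s_def)
  have "a powr (3 / 2) = a powr (1 + 1 / 2)" "a powr (5 / 2) = a powr (2 + 1 / 2)" by simp_all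
  then have powr_a: "a powr (3 / 2) = s ^ 3" "a powr (5 / 2) = s ^ 5"
    unfolding powr_add using a s
    by (simp_all add: powr_half_sqrt s_def[symmetric] as eval_nat_numeral)
  have DW: "(W has_real_derivative 2 * s * E x) (at x)" for x
    using gaussian_antiderivative_erf[OF a] by (simp add: W E s_def)
  have DE: "(E has_real_derivative - (2 * a * x + b) * E x) (at x)" for x
    unfolding E by (auto intro!: derivative_eq_intros simp: algebra_simps)
  \<comment> \<open>For F = R E + c W the derivative is (R' - (2ax + b) R + 2sc) E, so each case
    reduces to an identity without E and W.\<close>
  have antideriv: "(F has_real_derivative g) (at x)"
    if "(R has_real_derivative R') (at x)" "R' = (2 * a * x + b) * R x - 2 * s * c + r"
      "\<And>x. F x = R x * E x + c * W x" "g = r * E x"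
    for R R' x r c F g
  proof -
    have "((\<lambda>x. R x * E x + c * W x) has_real_derivative r * E x) (at x)"
      by (rule DERIV_cong[OF DERIV_add[OF DERIV_mult[OF that(1) DE] DERIV_cmult[OF DW]]])
         (simp add: that(2) algebra_simps)
    moreover have "F = (\<lambda>x. R x * E x + c * W x)" using that(3) by auto
    ultimately show ?thesis using that(4) by simp
  qed
  have indefI: "indef_integrals_eq f g F"
    if "\<And>x. x > 0 \<Longrightarrow> f x = g x" "\<And>x. x > 0 \<Longrightarrow> (F has_real_derivative g x) (at x)"
    for f g F :: "real \<Rightarrow> real"
    using that by (simp add: indef_integrals_eq_def)
  have K: "sqrt (2 / pi) *
      (exp (- a * x\<^sup>2) * b powr (7 / 2) * x powr (r + 1 / 2) * macdonald_K (7 / 2) (b * x))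
      = b ^ 3 * (x powr r * P x * E x)" if "x > 0" for r x
    using macdonald_K_seven_halves_integrand[OF b that] by (simp add: P E)
  show ?thesis
  proof (intro conjI; rule indefI)
    fix x :: real assume x: "x > 0"
    show "sqrt (2 / pi) *
        (exp (- a * x^2) * b powr (7/2) * x powr (1 + 1/2) * macdonald_K (7/2) (b * x))
      = b^3 * (x * P x * E x)"
      using K[OF x, of 1] x by simp
    show "sqrt (2 / pi) *
        (exp (- a * x^2) * b powr (7/2) * x powr (- 1 + 1/2) * macdonald_K (7/2) (b * x))
      = b^3 * (1 / x * P x * E x)"
      using K[OF x, of "- 1"] x by (simp add: powr_minus_divide)
    show "sqrt (2 / pi) *
        (exp (- a * x^2) * b powr (7/2) * x powr (- 3 + 1/2) * macdonald_K (7/2) (b * x))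
      = b^3 * (1 / x^3 * P x * E x)"
      using K[OF x, of "- 3"] x by (simp add: powr_minus_divide)
    \<comment> \<open>Reciprocal powers become powers of \<open>y\<close>, so the identities turn
      polynomial, with x y = 1 as the relation linking \<open>x\<close> and
      \<open>y\<close>.\<close>
    define y where "y = 1 / x"
    have xy: "x * y = 1" "x * (y * z) = z" for z using x by (simp_all add: y_def)
    have inv: "c / x = c * y" "c / x ^ n = c * y ^ n" for c n
      by (simp_all add: y_def power_divide)
    have inv_deriv: "((\<lambda>x. c / x) has_real_derivative - (c * y^2)) (at x)"
      "((\<lambda>x. c / x ^ n) has_real_derivative - (real n * c * y ^ Suc n)) (at x)" for c n
    proof -
      have pow: "((\<lambda>x. c / x ^ n) has_real_derivative - (real n * c * y ^ Suc n)) (at x)" for n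
      proof -
        have "((\<lambda>x. c * inverse x ^ n) has_real_derivative
            c * (real n * (inverse x ^ (n - Suc 0) * - (inverse x * inverse x)))) (at x)"
          using x
          by (intro DERIV_cmult DERIV_cong[OF DERIV_power] DERIV_cong[OF DERIV_inverse'[OF DERIV_ident]])
             (auto simp: ac_simps)
        moreover have "c * (real n * (inverse x ^ (n - Suc 0) * - (inverse x * inverse x)))
            = - (real n * c * y ^ Suc n)"
          \<comment> \<open>For n = 0 the exponent \<open>n - Suc 0\<close> truncates to 0, but the
            factor \<open>real n\<close> vanishes.\<close>
          by (cases n) (simp_all add: y_def inverse_eq_divide mult_ac)
        ultimately show ?thesis by (simp only: divide_inverse power_inverse)
      qed
      show "((\<lambda>x. c / x) has_real_derivative - (c * y^2)) (at x)"
        using pow[of 1] by (simp add: power2_eq_square)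
      show "((\<lambda>x. c / x ^ n) has_real_derivative - (real n * c * y ^ Suc n)) (at x)"
        by (rule pow)
    qed
    have bP: "b^3 * P x = 15 * y^3 + 15 * b * y^2 + 6 * b^2 * y + b^3"
      using b x unfolding P y_def by (simp add: field_simps eval_nat_numeral)
    have bP: "b^3 * (z * P x) = z * (15 * y^3 + 15 * b * y^2 + 6 * b^2 * y + b^3)" for z
      unfolding bP[symmetric] by simp
    show "((\<lambda>x. - ((60 * a^2 - 12 * a * b^2 + b^4) * W x / (4 * a powr (3/2)))
            - (30 * a + b^3 * x) * E x / (2 * a * x)) has_real_derivative b^3 * (x * P x * E x)) (at x)"
    proof -
      let ?R = "\<lambda>x. - ((30 * a + b^3 * x) / (2 * a * x))" and ?C = "60 * a^2 - 12 * a * b^2 + b^4"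
      \<comment> \<open>The constant part of R is -d; by 2ad = \<open>b^3\<close> it cancels the
        term \<open>b^3 * x\<close> of the integrand. The coefficient of W then cancels the terms
        constant in x.\<close>
      define d where "d = b^3 / (2 * a)"
      have ad: "b * (b * b) = 2 * (a * d)" using a by (simp add: d_def eval_nat_numeral)
      have "(?R has_real_derivative 15 * y^2) (at x)"
        using x a by (auto intro!: derivative_eq_intros simp: y_def) (simp add: field_simps eval_nat_numeral)
      moreover have "15 * y^2 = (2 * a * x + b) * ?R x - 2 * s * - (?C / (4 * s ^ 3)) + b^3 * (x * P x)"
      proof -
        have R: "?R x = - 15 * y - d" using x a by (simp add: y_def d_def field_simps)
        have C: "2 * s * - (?C / (4 * s ^ 3)) = - (30 * a - 6 * b^2 + b * d)"
          using s by (simp add: as d_def field_simps eval_nat_numeral)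
        show ?thesis unfolding R C bP by (simp add: algebra_simps eval_nat_numeral xy ad)
      qed
      ultimately show ?thesis unfolding powr_a by (rule antideriv) (simp_all add: mult_ac)
    qed
    show "((\<lambda>x. sqrt a * (10 * a - b^2) * W x
            + E x / x^3 * (10 * a * x^2 - b^2 * x^2 - 5 * b * x - 5))
        has_real_derivative b^3 * (1 / x * P x * E x)) (at x)"
    proof -
      let ?R = "\<lambda>x. (10 * a * x^2 - b^2 * x^2 - 5 * b * x - 5) / x^3"
      \<comment> \<open>The partial fractions must agree as functions, so x = 0 is included; there
        both sides are 0 by the convention for division by zero.\<close>
      have R: "?R x = (10 * a - b^2) / x - 5 * b / x^2 - 5 / x^3" for x
        by (cases "x = 0") (simp_all add: field_simps eval_nat_numeral)
      have "(?R has_real_derivative - (10 * a - b^2) * y^2 + 10 * b * y^3 + 15 * y^4) (at x)"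
        unfolding R
        by (rule DERIV_cong, (rule DERIV_diff inv_deriv)+) (simp add: algebra_simps)
      moreover have "- (10 * a - b^2) * y^2 + 10 * b * y^3 + 15 * y^4
          = (2 * a * x + b) * ?R x - 2 * s * (s * (10 * a - b^2)) + b^3 * (1 / x * P x)"
        unfolding R bP inv as by (simp add: algebra_simps eval_nat_numeral xy)
      ultimately show ?thesis unfolding s_def[symmetric] by (rule antideriv) (simp_all add: mult_ac)
    qed
    show "((\<lambda>x. E x * (- (4 * a^2 / x) + (2 * a - b^2) / x^3 + 2 * a * b / x^2
                    - 3 * b / x^4 - 3 / x^5)
            - 4 * a powr (5/2) * W x) has_real_derivative b^3 * (1 / x^3 * P x * E x)) (at x)"
    proof -
      let ?R = "\<lambda>x. - (4 * a^2 / x) + (2 * a - b^2) / x^3 + 2 * a * b / x^2 - 3 * b / x^4 - 3 / x^5"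
      let ?R' = "4 * a^2 * y^2 - 3 * (2 * a - b^2) * y^4 - 4 * a * b * y^3 + 12 * b * y^5 + 15 * y^6"
      have "(?R has_real_derivative ?R') (at x)"
        by (rule DERIV_cong, (rule DERIV_add DERIV_diff DERIV_minus inv_deriv)+)
           (simp add: algebra_simps)
      \<comment> \<open>The coefficient \<open>- 4 * s^5\<close> of W is forced: it cancels the
        constant \<open>-8 * a^3\<close> arising from 2ax times the leading term of R.\<close>
      moreover have "?R' = (2 * a * x + b) * ?R x - 2 * s * (- 4 * s^5) + b^3 * (1 / x^3 * P x)"
        unfolding bP inv as by (simp add: algebra_simps eval_nat_numeral xy)
      ultimately show ?thesis unfolding powr_a by (rule antideriv) (simp_all add: mult_ac)
    qed
  qed
qed

end
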